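(* Let $b$ be a locally finite connected weighted graph over $(X,m)$. The following assertions are equivalent. (i) There exists a unique maximal intrinsic metric (with respect to $b$ and $m$). (ii) $b$ is a star graph and it has a center $p\in X$ such that $$\sum_{x\in X\setminus\{p\}} m(x)\le m(p).$$
   Context: $X$ is a nonempty countable (finite or countably infinite) set and $m\colon X\to(0,\infty)$. A weighted graph over $(X,m)$ is a symmetric function $b\colon X\times X\to[0,\infty)$ with $b(x,x)=0$ and $\sum_{y\in X}b(x,y)<\infty$ for all $x\in X$. Write $x\sim y$ if $b(x,y)>0$. The graph is locally finite if $\{y\in X\mid y\sim x\}$ is finite for every $x$; it is connected if for all $x,y\in X$ there is a finite sequence $x=x_0\sim x_1\sim\dots\sim x_n=y$ ($n\ge 0$). Let $N(x)=|\{y\in X\mid x\sim y\}|$. A pseudo metric on $X$ is a symmetric function $\sigma\colon X\times X\to[0,\infty)$ with $\sigma(x,x)=0$ satisfying the triangle inequality; it is a metric if moreover $\sigma(x,y)=0$ only for $x=y$. A (pseudo) metric is intrinsic with respect to $b$ and $m$ if $\frac1{m(x)}\sum_{y\in X}b(x,y)\sigma(x,y)^2\le 1$ for every $x\in X$. An intrinsic pseudo metric $\sigma$ (in particular, an intrinsic metric) is called maximal if for any other intrinsic pseudo metric $\varrho$ the inequality $\sigma(x,y)\le\varrho(x,y)$ for all $x,y\in X$ implies $\varrho=\sigma$. A star graph is a connected graph for which there exists $p\in X$ with $N(x)=1$ for all $x\in X\setminus\{p\}$; any such $p$ is called a center of $b$. *)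

theory Defs
  imports "HOL-Analysis.Analysis"
begin

text \<open>The vertex set is the universe of a type of class countable, so it is nonempty and
  finite or countably infinite.\<close>

definition weighted_graph :: "('a::countable \<Rightarrow> 'a \<Rightarrow> real) \<Rightarrow> bool" where
  "weighted_graph b \<longleftrightarrow>
     (\<forall>x y. 0 \<le> b x y) \<and> (\<forall>x y. b x y = b y x) \<and> (\<forall>x. b x x = 0) \<and>
     (\<forall>x. (\<lambda>y. b x y) summable_on UNIV)"

definition adjacent :: "('a::countable \<Rightarrow> 'a \<Rightarrow> real) \<Rightarrow> 'a \<Rightarrow> 'a \<Rightarrow> bool" where
  "adjacent b x y \<longleftrightarrow> b x y > 0"

definition locally_finite_graph :: "('a::countable \<Rightarrow> 'a \<Rightarrow> real) \<Rightarrow> bool" where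
  "locally_finite_graph b \<longleftrightarrow> (\<forall>x. finite {y. adjacent b y x})"

definition connected_graph :: "('a::countable \<Rightarrow> 'a \<Rightarrow> real) \<Rightarrow> bool" where
  "connected_graph b \<longleftrightarrow> (\<forall>x y. (adjacent b)\<^sup>*\<^sup>* x y)"

text \<open>A vertex with infinitely many neighbours gets the value 0 here. This is harmless because
  the number is only ever compared with 1.\<close>

definition num_neighbours :: "('a::countable \<Rightarrow> 'a \<Rightarrow> real) \<Rightarrow> 'a \<Rightarrow> nat" where
  "num_neighbours b x = card {y. adjacent b x y}"

definition is_center :: "('a::countable \<Rightarrow> 'a \<Rightarrow> real) \<Rightarrow> 'a \<Rightarrow> bool" where
  "is_center b p \<longleftrightarrow> (\<forall>x. x \<noteq> p \<longrightarrow> num_neighbours b x = 1)"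

definition star_graph :: "('a::countable \<Rightarrow> 'a \<Rightarrow> real) \<Rightarrow> bool" where
  "star_graph b \<longleftrightarrow> connected_graph b \<and> (\<exists>p. is_center b p)"

definition pseudo_metric :: "('a \<Rightarrow> 'a \<Rightarrow> real) \<Rightarrow> bool" where
  "pseudo_metric \<sigma> \<longleftrightarrow>
     (\<forall>x y. 0 \<le> \<sigma> x y) \<and> (\<forall>x y. \<sigma> x y = \<sigma> y x) \<and> (\<forall>x. \<sigma> x x = 0) \<and>
     (\<forall>x y z. \<sigma> x z \<le> \<sigma> x y + \<sigma> y z)"

text \<open>Summability is part of the condition: the sum of nonnegative terms is understood in
  the extended reals, whereas \<open>infsum\<close> is 0 on divergent real families.\<close>

definition intrinsic ::
  "('a::countable \<Rightarrow> 'a \<Rightarrow> real) \<Rightarrow> ('a \<Rightarrow> real) \<Rightarrow> ('a \<Rightarrow> 'a \<Rightarrow> real) \<Rightarrow> bool" where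
  "intrinsic b m \<sigma> \<longleftrightarrow>
     (\<forall>x. (\<lambda>y. b x y * (\<sigma> x y)\<^sup>2) summable_on UNIV \<and>
          1 / m x * (\<Sum>\<^sub>\<infinity>y. b x y * (\<sigma> x y)\<^sup>2) \<le> 1)"

definition maximal_intrinsic ::
  "('a::countable \<Rightarrow> 'a \<Rightarrow> real) \<Rightarrow> ('a \<Rightarrow> real) \<Rightarrow> ('a \<Rightarrow> 'a \<Rightarrow> real) \<Rightarrow> bool" where
  "maximal_intrinsic b m \<sigma> \<longleftrightarrow>
     pseudo_metric \<sigma> \<and> intrinsic b m \<sigma> \<and>
     (\<forall>\<rho>. pseudo_metric \<rho> \<and> intrinsic b m \<rho> \<and> (\<forall>x y. \<sigma> x y \<le> \<rho> x y) \<longrightarrow> \<rho> = \<sigma>)"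

lemma Metric_space_UNIV_iff_pseudo_metric:
  "Metric_space UNIV \<sigma> \<longleftrightarrow> pseudo_metric \<sigma> \<and> (\<forall>x y. \<sigma> x y = 0 \<longrightarrow> x = y)"
  unfolding Metric_space_def pseudo_metric_def by auto

end

theory Submission
  imports Defs
begin

text \<open>The equivalence rests on replacing ``unique maximal'' by ``largest''. Every intrinsic pseudo
  metric lies below a maximal one (\<open>ex_maximal_above\<close>, by Zorn's lemma). Uniqueness is only assumed
  among maximal metrics, but if \<open>\<sigma>\<close> is the unique one and \<open>\<rho>\<close> is any intrinsic pseudo metric, then
  the mean \<open>(\<rho> + \<sigma>) / 2\<close> is an intrinsic metric, hence lies below \<open>\<sigma>\<close>; so \<open>\<rho> \<le> \<sigma>\<close>
  (\<open>unique_maximal_metric_is_largest\<close>).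

  A largest intrinsic metric \<open>\<sigma>\<close> makes all edges simultaneously as long as possible, whereas edges
  at a common vertex compete for the budget \<open>m\<close> of that vertex. The competition is detected by cut
  pseudo metrics, which take the value \<open>c\<close> between a set \<open>U\<close> and its complement and \<open>0\<close>
  elsewhere. Taking \<open>c = \<sigma> u v\<close> for a pair \<open>u, v\<close> separated by \<open>U\<close>, some vertex must be
  saturated, as otherwise a slightly larger \<open>c\<close> would beat \<open>\<sigma>\<close> (\<open>cut_saturated\<close>).

  Suppose that an edge joins two vertices that both have further neighbours. For \<open>U\<close> consisting of
  \<open>x\<close> and the leaves attached to it, and \<open>c\<close> the distance from \<open>x\<close> to its nearest neighbour outside
  \<open>U\<close>, only \<open>x\<close> itself can be saturated, and this forces that \<open>x\<close> has no leaves and that all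
  its edges have the same length (\<open>equidistant_non_leaf_nbrs\<close>). By connectedness the whole graph then
  has no leaves and a single edge length \<open>L\<close>. But there is a metric with an edge longer
  than \<open>L\<close>: give all other pairs the distance \<open>3/4 * L\<close>, which frees budget at both
  ends of that edge. So every edge has a leaf as an endpoint (\<open>every_edge_has_leaf\<close>), which makes the
  graph a star. Cutting off one leaf \<open>x\<close> shows that its edge uses the full budget \<open>m x\<close>
  (if the whole graph is one edge, this holds for its lighter end, and the heavier one is the center),
  and the intrinsic condition at the center becomes the inequality of masses.

  Conversely, on such a star each leaf can be put at the largest distance from the center that its
  own budget permits, and the resulting path metric dominates every intrinsic
  pseudo metric.\<close>

section \<open>Pseudo metrics\<close>

lemma pseudo_metricI:
  assumes "\<And>x y. 0 \<le> \<sigma> x y" "\<And>x y. \<sigma> x y = \<sigma> y x" "\<And>x. \<sigma> x x = 0"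
    "\<And>x y z. \<sigma> x z \<le> \<sigma> x y + \<sigma> y z"
  shows "pseudo_metric \<sigma>"
  using assms unfolding pseudo_metric_def by blast

lemma pseudo_metricD:
  assumes "pseudo_metric \<sigma>"
  shows "0 \<le> \<sigma> x y" "\<sigma> x y = \<sigma> y x" "\<sigma> x x = 0" "\<sigma> x z \<le> \<sigma> x y + \<sigma> y z"
  using assms unfolding pseudo_metric_def by blast+

text \<open>The source of all contradictions below: a length at which finitely many quadratic constraints
  are strict can still be increased.\<close>

lemma enlarge_within_strict_bounds:
  fixes A B :: "'i \<Rightarrow> real"
  assumes "finite I" "\<And>i. i \<in> I \<Longrightarrow> A i * L\<^sup>2 < B i"
  shows "\<exists>c>L. \<forall>i\<in>I. A i * c\<^sup>2 \<le> B i"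
proof -
  have "\<forall>\<^sub>F c in at_right L. A i * c\<^sup>2 < B i" if "i \<in> I" for i
  proof -
    have "((\<lambda>c. A i * c\<^sup>2) \<longlongrightarrow> A i * L\<^sup>2) (at_right L)"
      by (intro tendsto_intros)
    then show ?thesis
      using assms(2)[OF that] by (rule order_tendstoD(2))
  qed
  then have "\<forall>\<^sub>F c in at_right L. \<forall>i\<in>I. A i * c\<^sup>2 < B i"
    using assms(1) by (simp add: eventually_ball_finite)
  moreover have "\<forall>\<^sub>F c in at_right L. L < c"
    by (rule eventually_at_right_less)
  ultimately have "\<forall>\<^sub>F c in at_right L. L < c \<and> (\<forall>i\<in>I. A i * c\<^sup>2 < B i)"
    by eventually_elim simp
  then obtain c where "L < c" "\<forall>i\<in>I. A i * c\<^sup>2 < B i"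
    using eventually_happens'[OF trivial_limit_at_right_real] by blast
  then show ?thesis
    by (intro exI[of _ c]) (auto intro: less_imp_le)
qed

text \<open>If all distances lie between \<open>a\<close> and \<open>2 * a\<close>, no detour can be shorter than a direct step, so the
  distances can be varied independently of each other.\<close>

lemma pseudo_metric_two_to_one:
  assumes "0 \<le> a"
    and "\<And>u v. u \<noteq> v \<Longrightarrow> a \<le> d u v \<and> d u v \<le> 2 * a"
    and "\<And>u v. d u v = d v u" and "\<And>u. d u u = 0"
  shows "pseudo_metric d"
proof (rule pseudo_metricI)
  have nonneg: "0 \<le> d u v" for u v
    using assms(1) assms(2)[of u v] assms(4)[of u] by (cases "u = v") auto
  then show "0 \<le> d u v" for u v .
  show "d u w \<le> d u v + d v w" for u v w
  proof (cases "u = v \<or> v = w \<or> u = w")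
    case True
    then show ?thesis using nonneg[of u v] nonneg[of v w] assms(4) by auto
  next
    case False
    then show ?thesis
      using assms(2)[of u v] assms(2)[of v w] assms(2)[of u w] by auto
  qed
qed (use assms in auto)

definition cut_pseudo_metric :: "'a set \<Rightarrow> real \<Rightarrow> 'a \<Rightarrow> 'a \<Rightarrow> real" where
  "cut_pseudo_metric U c u v = (if u \<in> U \<longleftrightarrow> v \<in> U then 0 else c)"

lemma pseudo_metric_cut:
  "0 \<le> c \<Longrightarrow> pseudo_metric (cut_pseudo_metric U c)"
  by (rule pseudo_metricI) (auto simp: cut_pseudo_metric_def)

text \<open>A pointwise supremum need not be attained along a chain, but because the chain is totally
  ordered a single member serves all indices of a finite set at once. Local finiteness of the
  graph is what makes this enough: the intrinsic condition at a vertex involves only finitely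
  many values.\<close>

lemma chain_simultaneous_approx:
  fixes C :: "('a \<Rightarrow> 'b \<Rightarrow> real) set"
  assumes "C \<noteq> {}" and chain: "\<And>\<sigma> \<tau>. \<sigma> \<in> C \<Longrightarrow> \<tau> \<in> C \<Longrightarrow> \<sigma> \<le> \<tau> \<or> \<tau> \<le> \<sigma>"
    and bdd: "\<And>y. bdd_above ((\<lambda>\<sigma>. \<sigma> x y) ` C)"
    and "finite F" "0 < e"
  shows "\<exists>\<sigma>\<in>C. \<forall>y\<in>F. (SUP \<sigma>\<in>C. \<sigma> x y) - e < \<sigma> x y"
  using \<open>finite F\<close>
proof (induction F rule: finite_induct)
  case empty
  then show ?case using \<open>C \<noteq> {}\<close> by auto
next
  case (insert z F)
  then obtain \<sigma> where \<sigma>: "\<sigma> \<in> C" "\<forall>y\<in>F. (SUP \<sigma>\<in>C. \<sigma> x y) - e < \<sigma> x y"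
    by blast
  have "(SUP \<sigma>\<in>C. \<sigma> x z) - e < (SUP \<sigma>\<in>C. \<sigma> x z)"
    using \<open>0 < e\<close> by simp
  then obtain \<tau> where \<tau>: "\<tau> \<in> C" "(SUP \<sigma>\<in>C. \<sigma> x z) - e < \<tau> x z"
    using \<open>C \<noteq> {}\<close> bdd by (auto simp: less_cSUP_iff)
  from chain[OF \<sigma>(1) \<tau>(1)] show ?case
  proof
    assume le: "\<sigma> \<le> \<tau>"
    have "(SUP \<sigma>\<in>C. \<sigma> x y) - e < \<tau> x y" if "y \<in> insert z F" for y
      using that \<sigma> \<tau> le_funD[OF le_funD[OF le], of x y] by fastforce
    then show ?thesis using \<tau>(1) by blast
  next
    assume le: "\<tau> \<le> \<sigma>"
    have "(SUP \<sigma>\<in>C. \<sigma> x y) - e < \<sigma> x y" if "y \<in> insert z F" for y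
      using that \<sigma> \<tau> le_funD[OF le_funD[OF le], of x y] by fastforce
    then show ?thesis using \<sigma>(1) by blast
  qed
qed

section \<open>Intrinsic pseudo metrics on locally finite graphs\<close>

definition nbrs :: "('a::countable \<Rightarrow> 'a \<Rightarrow> real) \<Rightarrow> 'a \<Rightarrow> 'a set" where
  "nbrs b x = {y. adjacent b x y}"

locale lf_connected_graph =
  fixes b :: "'a::countable \<Rightarrow> 'a \<Rightarrow> real" and m :: "'a \<Rightarrow> real"
  assumes m_pos: "m x > 0"
    and graph: "weighted_graph b"
    and lf: "locally_finite_graph b"
    and conn: "connected_graph b"
begin

lemma b_nonneg: "0 \<le> b x y" and b_sym: "b x y = b y x" and b_irrefl: "b x x = 0"
  using graph unfolding weighted_graph_def by blast+

lemma nbrs_iff: "y \<in> nbrs b x \<longleftrightarrow> b x y > 0"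
  by (simp add: nbrs_def adjacent_def)

lemma nbrs_sym: "y \<in> nbrs b x \<longleftrightarrow> x \<in> nbrs b y"
  by (simp add: nbrs_iff b_sym)

lemma nbrs_irrefl: "x \<notin> nbrs b x"
  by (simp add: nbrs_iff b_irrefl)

lemma finite_nbrs: "finite (nbrs b x)"
proof -
  have "nbrs b x = {y. adjacent b y x}"
    by (auto simp: nbrs_def adjacent_def b_sym)
  then show ?thesis
    using lf by (simp add: locally_finite_graph_def)
qed

lemma b_not_nbr: "y \<notin> nbrs b x \<Longrightarrow> b x y = 0"
  using b_nonneg[of x y] by (simp add: nbrs_iff)

lemma connected_induct:
  assumes "P x" "\<And>u v. P u \<Longrightarrow> v \<in> nbrs b u \<Longrightarrow> P v"
  shows "P y"
proof -
  have "(adjacent b)\<^sup>*\<^sup>* x y"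
    using conn by (simp add: connected_graph_def)
  then show ?thesis
    using assms by (induction rule: rtranclp_induct) (auto simp: nbrs_def)
qed

lemma intrinsic_iff:
  "intrinsic b m \<sigma> \<longleftrightarrow> (\<forall>x. (\<Sum>y\<in>nbrs b x. b x y * (\<sigma> x y)\<^sup>2) \<le> m x)"
proof -
  have "(\<lambda>y. b x y * (\<sigma> x y)\<^sup>2) summable_on UNIV \<longleftrightarrow>
      (\<lambda>y. b x y * (\<sigma> x y)\<^sup>2) summable_on nbrs b x" for x
    by (rule summable_on_cong_neutral) (auto simp: b_not_nbr)
  moreover have "(\<Sum>\<^sub>\<infinity>y. b x y * (\<sigma> x y)\<^sup>2) = (\<Sum>\<^sub>\<infinity>y\<in>nbrs b x. b x y * (\<sigma> x y)\<^sup>2)" for x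
    by (rule infsum_cong_neutral) (auto simp: b_not_nbr)
  moreover have "1 / m x * s \<le> 1 \<longleftrightarrow> s \<le> m x" for x s
    using m_pos[of x] by (simp add: field_simps)
  ultimately show ?thesis
    unfolding intrinsic_def by (simp add: finite_nbrs)
qed

lemma intrinsicD:
  "intrinsic b m \<sigma> \<Longrightarrow> (\<Sum>y\<in>nbrs b x. b x y * (\<sigma> x y)\<^sup>2) \<le> m x"
  by (simp add: intrinsic_iff)

lemma intrinsic_edge_le:
  assumes "intrinsic b m \<sigma>"
  shows "b x y * (\<sigma> x y)\<^sup>2 \<le> m x"
proof (cases "y \<in> nbrs b x")
  case True
  then have "b x y * (\<sigma> x y)\<^sup>2 \<le> (\<Sum>y\<in>nbrs b x. b x y * (\<sigma> x y)\<^sup>2)"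
    by (intro member_le_sum) (auto simp: b_nonneg finite_nbrs)
  then show ?thesis
    using intrinsicD[OF assms, of x] by linarith
next
  case False
  then show ?thesis
    using m_pos[of x] by (simp add: b_not_nbr)
qed

text \<open>The condition at \<open>x\<close> bounds the length of every edge at \<open>x\<close>, and the triangle inequality
  carries the bounds along paths. Hence pointwise suprema of intrinsic pseudo metrics are finite.\<close>

lemma intrinsic_pseudo_metrics_bounded:
  "\<exists>K. \<forall>\<sigma>. pseudo_metric \<sigma> \<longrightarrow> intrinsic b m \<sigma> \<longrightarrow> \<sigma> x y \<le> K"
proof (rule connected_induct[of _ x])
  show "\<exists>K. \<forall>\<sigma>. pseudo_metric \<sigma> \<longrightarrow> intrinsic b m \<sigma> \<longrightarrow> \<sigma> x x \<le> K"
    by (auto simp: pseudo_metricD)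
next
  fix u v
  assume "\<exists>K. \<forall>\<sigma>. pseudo_metric \<sigma> \<longrightarrow> intrinsic b m \<sigma> \<longrightarrow> \<sigma> x u \<le> K" and v: "v \<in> nbrs b u"
  then obtain K where K: "\<And>\<sigma>. pseudo_metric \<sigma> \<Longrightarrow> intrinsic b m \<sigma> \<Longrightarrow> \<sigma> x u \<le> K"
    by blast
  have "\<sigma> x v \<le> K + sqrt (m u / b u v)" if \<sigma>: "pseudo_metric \<sigma>" "intrinsic b m \<sigma>" for \<sigma>
  proof -
    have "(\<sigma> u v)\<^sup>2 \<le> m u / b u v"
      using intrinsic_edge_le[OF \<sigma>(2), of u v] v by (simp add: nbrs_iff field_simps)
    then have "\<sigma> u v \<le> sqrt (m u / b u v)"
      by (rule real_le_rsqrt)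
    then show ?thesis
      using K[OF \<sigma>] pseudo_metricD(4)[OF \<sigma>(1), of x v u] by linarith
  qed
  then show "\<exists>K. \<forall>\<sigma>. pseudo_metric \<sigma> \<longrightarrow> intrinsic b m \<sigma> \<longrightarrow> \<sigma> x v \<le> K"
    by blast
qed

lemma chain_SUP_intrinsic:
  fixes C :: "('a \<Rightarrow> 'a \<Rightarrow> real) set"
  assumes "C \<noteq> {}" and chain: "\<And>\<sigma> \<tau>. \<sigma> \<in> C \<Longrightarrow> \<tau> \<in> C \<Longrightarrow> \<sigma> \<le> \<tau> \<or> \<tau> \<le> \<sigma>"
    and C: "\<And>\<sigma>. \<sigma> \<in> C \<Longrightarrow> pseudo_metric \<sigma> \<and> intrinsic b m \<sigma>"
  defines "u \<equiv> \<lambda>x y. SUP \<sigma>\<in>C. \<sigma> x y"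
  shows "pseudo_metric u" "intrinsic b m u" "\<And>\<sigma>. \<sigma> \<in> C \<Longrightarrow> \<sigma> \<le> u"
proof -
  have bdd: "bdd_above ((\<lambda>\<sigma>. \<sigma> x y) ` C)" for x y
  proof -
    obtain K where "\<And>\<sigma>. pseudo_metric \<sigma> \<Longrightarrow> intrinsic b m \<sigma> \<Longrightarrow> \<sigma> x y \<le> K"
      using intrinsic_pseudo_metrics_bounded[of x y] by blast
    then show ?thesis
      using C by (intro bdd_aboveI2[where M = K]) auto
  qed
  have upper: "\<sigma> x y \<le> u x y" if "\<sigma> \<in> C" for \<sigma> x y
    unfolding u_def by (rule cSUP_upper[OF that bdd])
  then show "\<sigma> \<le> u" if "\<sigma> \<in> C" for \<sigma>
    using that by (simp add: le_fun_def)
  have least: "u x y \<le> K" if "\<And>\<sigma>. \<sigma> \<in> C \<Longrightarrow> \<sigma> x y \<le> K" for x y K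
    unfolding u_def using \<open>C \<noteq> {}\<close> that by (rule cSUP_least)
  obtain \<sigma>0 where \<sigma>0: "\<sigma>0 \<in> C" using \<open>C \<noteq> {}\<close> by blast
  have nonneg: "0 \<le> u x y" for x y
    using upper[OF \<sigma>0, of x y] pseudo_metricD(1)[of \<sigma>0 x y] C[OF \<sigma>0] by linarith
  show "pseudo_metric u"
  proof (rule pseudo_metricI)
    fix x y z
    show "u x y = u y x"
      unfolding u_def using C by (intro SUP_cong[OF refl]) (rule pseudo_metricD(2), simp)
    show "u x x = 0"
      using nonneg[of x x] least[of x x 0] C by (simp add: pseudo_metricD order.antisym)
    show "u x z \<le> u x y + u y z"
    proof (rule least)
      fix \<sigma> assume "\<sigma> \<in> C"
      then show "\<sigma> x z \<le> u x y + u y z"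
        using pseudo_metricD(4)[of \<sigma> x z y] C[of \<sigma>] upper[of \<sigma> x y] upper[of \<sigma> y z] by linarith
    qed
  qed (rule nonneg)
  show "intrinsic b m u"
    unfolding intrinsic_iff
  proof
    fix x
    \<comment> \<open>Cutting off at 0 keeps squaring monotone when \<open>u x y < e\<close>.\<close>
    have "(\<Sum>y\<in>nbrs b x. b x y * (max 0 (u x y - e))\<^sup>2) \<le> m x" if e: "0 < e" for e
    proof -
      obtain \<sigma> where \<sigma>: "\<sigma> \<in> C" "\<And>y. y \<in> nbrs b x \<Longrightarrow> u x y - e < \<sigma> x y"
        using chain_simultaneous_approx[OF \<open>C \<noteq> {}\<close> chain bdd finite_nbrs e, of x x]
        unfolding u_def by blast
      have "(\<Sum>y\<in>nbrs b x. b x y * (max 0 (u x y - e))\<^sup>2) \<le> (\<Sum>y\<in>nbrs b x. b x y * (\<sigma> x y)\<^sup>2)"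
        using \<sigma> C[OF \<sigma>(1)]
        by (intro sum_mono mult_left_mono power_mono)
          (auto simp: b_nonneg pseudo_metricD intro: less_imp_le)
      also have "\<dots> \<le> m x"
        using C[OF \<sigma>(1)] by (simp add: intrinsicD)
      finally show ?thesis .
    qed
    then have "\<forall>\<^sub>F e in at_right 0. (\<Sum>y\<in>nbrs b x. b x y * (max 0 (u x y - e))\<^sup>2) \<le> m x"
      by (rule eventually_mono[OF eventually_at_right_less])
    moreover have "((\<lambda>e. \<Sum>y\<in>nbrs b x. b x y * (max 0 (u x y - e))\<^sup>2) \<longlongrightarrow>
        (\<Sum>y\<in>nbrs b x. b x y * (max 0 (u x y - 0))\<^sup>2)) (at_right 0)"
      by (intro tendsto_intros)
    ultimately have "(\<Sum>y\<in>nbrs b x. b x y * (max 0 (u x y - 0))\<^sup>2) \<le> m x"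
      by (intro tendsto_upperbound[OF _ _ trivial_limit_at_right_real])
    then show "(\<Sum>y\<in>nbrs b x. b x y * (u x y)\<^sup>2) \<le> m x"
      using nonneg by (simp add: max_absorb2)
  qed
qed

lemma ex_maximal_above:
  assumes "pseudo_metric \<rho>" "intrinsic b m \<rho>"
  shows "\<exists>\<sigma>. maximal_intrinsic b m \<sigma> \<and> (\<forall>x y. \<rho> x y \<le> \<sigma> x y)"
proof -
  define A where "A = {\<sigma>. pseudo_metric \<sigma> \<and> intrinsic b m \<sigma> \<and> \<rho> \<le> \<sigma>}"
  have "\<exists>\<sigma>\<in>A. \<forall>\<tau>\<in>A. \<sigma> \<le> \<tau> \<longrightarrow> \<tau> = \<sigma>"
  proof (rule predicate_Zorn)
    show "partial_order_on A (relation_of (\<le>) A)"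
      by (rule partial_order_on_relation_ofI) auto
  next
    fix C assume C: "C \<in> Chains (relation_of (\<le>) A)"
    have CA: "C \<subseteq> A"
      using C by (auto simp: Chains_def relation_of_def)
    show "\<exists>\<sigma>\<in>A. \<forall>\<tau>\<in>C. \<tau> \<le> \<sigma>"
    proof (cases "C = {}")
      case True
      then show ?thesis using assms by (auto simp: A_def)
    next
      case False
      let ?u = "\<lambda>x y. SUP \<sigma>\<in>C. \<sigma> x y"
      have chain: "\<sigma> \<le> \<tau> \<or> \<tau> \<le> \<sigma>" if "\<sigma> \<in> C" "\<tau> \<in> C" for \<sigma> \<tau>
        using C that by (auto simp: Chains_def relation_of_def)
      have good: "pseudo_metric \<sigma> \<and> intrinsic b m \<sigma>" if "\<sigma> \<in> C" for \<sigma>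
        using that CA by (auto simp: A_def)
      note u = chain_SUP_intrinsic[OF False chain good]
      obtain \<sigma>0 where "\<sigma>0 \<in> C" using False by blast
      then have "\<rho> \<le> ?u"
        using CA u(3)[of \<sigma>0] by (auto simp: A_def intro: order.trans)
      then have "?u \<in> A"
        using u(1,2) by (simp add: A_def)
      then show ?thesis using u(3) by blast
    qed
  qed
  then obtain \<sigma> where \<sigma>: "\<sigma> \<in> A" "\<And>\<tau>. \<tau> \<in> A \<Longrightarrow> \<sigma> \<le> \<tau> \<Longrightarrow> \<tau> = \<sigma>"
    by blast
  have "\<tau> = \<sigma>" if "pseudo_metric \<tau>" "intrinsic b m \<tau>" "\<forall>x y. \<sigma> x y \<le> \<tau> x y" for \<tau>
  proof -
    have "\<sigma> \<le> \<tau>" using that(3) by (simp add: le_fun_def)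
    then show ?thesis
      using \<sigma> that by (auto simp: A_def)
  qed
  then show ?thesis
    using \<sigma>(1) unfolding maximal_intrinsic_def A_def by (auto simp: le_fun_def)
qed

text \<open>The mean with \<open>\<sigma>\<close> turns a pseudo metric \<open>\<rho>\<close> into a metric, so that any maximal element above the mean
  is a metric and uniqueness applies to it. The mean remains intrinsic because squaring is convex.\<close>

lemma unique_maximal_metric_is_largest:
  assumes \<sigma>: "Metric_space UNIV \<sigma>" "maximal_intrinsic b m \<sigma>"
    and unique: "\<And>\<tau>. Metric_space UNIV \<tau> \<Longrightarrow> maximal_intrinsic b m \<tau> \<Longrightarrow> \<tau> = \<sigma>"
    and \<rho>: "pseudo_metric \<rho>" "intrinsic b m \<rho>"
  shows "\<rho> x y \<le> \<sigma> x y"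
proof -
  define \<mu> where "\<mu> x y = (\<rho> x y + \<sigma> x y) / 2" for x y
  have pm: "pseudo_metric \<sigma>" and intr: "intrinsic b m \<sigma>"
    using \<sigma>(2) by (auto simp: maximal_intrinsic_def)
  have "pseudo_metric \<mu>"
  proof (rule pseudo_metricI)
    fix x y z
    show "\<mu> x y = \<mu> y x"
      by (simp add: \<mu>_def pseudo_metricD(2)[OF \<rho>(1), of x y] pseudo_metricD(2)[OF pm, of x y])
    show "\<mu> x z \<le> \<mu> x y + \<mu> y z"
      using pseudo_metricD(4)[OF \<rho>(1), of x z y] pseudo_metricD(4)[OF pm, of x z y]
      by (simp add: \<mu>_def field_simps)
  qed (simp_all add: \<mu>_def pseudo_metricD \<rho> pm)
  moreover have "intrinsic b m \<mu>"
    unfolding intrinsic_iff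
  proof
    fix x
    have "b x y * (\<mu> x y)\<^sup>2 \<le> (b x y * (\<rho> x y)\<^sup>2 + b x y * (\<sigma> x y)\<^sup>2) / 2" for y
    proof -
      have "(\<mu> x y)\<^sup>2 \<le> ((\<rho> x y)\<^sup>2 + (\<sigma> x y)\<^sup>2) / 2"
        using sum_squares_bound[of "\<rho> x y" "\<sigma> x y"]
        by (simp add: \<mu>_def power2_eq_square field_simps)
      from mult_left_mono[OF this b_nonneg[of x y]] show ?thesis
        by (simp add: algebra_simps)
    qed
    then have "(\<Sum>y\<in>nbrs b x. b x y * (\<mu> x y)\<^sup>2) \<le>
        (\<Sum>y\<in>nbrs b x. (b x y * (\<rho> x y)\<^sup>2 + b x y * (\<sigma> x y)\<^sup>2) / 2)"
      by (intro sum_mono)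
    also have "\<dots> = ((\<Sum>y\<in>nbrs b x. b x y * (\<rho> x y)\<^sup>2) + (\<Sum>y\<in>nbrs b x. b x y * (\<sigma> x y)\<^sup>2)) / 2"
      by (simp add: sum.distrib sum_divide_distrib add_divide_distrib)
    also have "\<dots> \<le> m x"
      using intrinsicD[OF \<rho>(2), of x] intrinsicD[OF intr, of x] by simp
    finally show "(\<Sum>y\<in>nbrs b x. b x y * (\<mu> x y)\<^sup>2) \<le> m x" .
  qed
  ultimately obtain \<tau> where \<tau>: "maximal_intrinsic b m \<tau>" "\<And>x y. \<mu> x y \<le> \<tau> x y"
    using ex_maximal_above by blast
  have "x = y" if "\<tau> x y = 0" for x y
  proof -
    have "\<sigma> x y = 0"
      using \<tau>(2)[of x y] that pseudo_metricD(1)[OF pm, of x y] pseudo_metricD(1)[OF \<rho>(1), of x y]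
      by (simp add: \<mu>_def)
    then show ?thesis
      using \<sigma>(1) by (simp add: Metric_space_UNIV_iff_pseudo_metric)
  qed
  then have "Metric_space UNIV \<tau>"
    using \<tau>(1) by (auto simp: Metric_space_UNIV_iff_pseudo_metric maximal_intrinsic_def)
  then have "\<tau> = \<sigma>"
    using unique \<tau>(1) by blast
  then show ?thesis
    using \<tau>(2)[of x y] by (simp add: \<mu>_def)
qed

end

section \<open>The largest intrinsic metric forces a star\<close>

locale largest_intrinsic_metric = lf_connected_graph b m
  for b :: "'a::countable \<Rightarrow> 'a \<Rightarrow> real" and m :: "'a \<Rightarrow> real" +
  fixes \<sigma> :: "'a \<Rightarrow> 'a \<Rightarrow> real"
  assumes pm: "pseudo_metric \<sigma>" and intr: "intrinsic b m \<sigma>"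
    and pos: "x \<noteq> y \<Longrightarrow> 0 < \<sigma> x y"
    and largest: "pseudo_metric \<rho> \<Longrightarrow> intrinsic b m \<rho> \<Longrightarrow> \<rho> x y \<le> \<sigma> x y"
begin

lemma edge_pos:
  assumes "y \<in> nbrs b x"
  shows "0 < b x y" "0 < \<sigma> x y"
proof -
  show "0 < b x y" using assms by (simp add: nbrs_iff)
  have "x \<noteq> y" using assms nbrs_irrefl by auto
  then show "0 < \<sigma> x y" by (rule pos)
qed

definition cut_weight :: "'a set \<Rightarrow> 'a \<Rightarrow> real" where
  "cut_weight U w = (\<Sum>v \<in> {v \<in> nbrs b w. (w \<in> U) \<noteq> (v \<in> U)}. b w v)"

text \<open>The budget at \<open>w\<close> that a cut pseudo metric of height \<open>c\<close> consumes is \<open>cut_weight U w * c\<^sup>2\<close>. If the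
  height \<open>\<sigma> u v\<close> left room at every vertex, a slightly larger height would still be intrinsic,
  although \<open>\<sigma>\<close> is the largest. Finiteness of the set of vertices at the cut ensures that one
  larger height fits all of them.\<close>

lemma cut_saturated:
  assumes fin: "finite {w. cut_weight U w \<noteq> 0}" and uv: "u \<in> U" "v \<notin> U"
  shows "\<exists>w. m w \<le> cut_weight U w * (\<sigma> u v)\<^sup>2"
proof (rule ccontr)
  assume "\<not> ?thesis"
  then have strict: "cut_weight U w * (\<sigma> u v)\<^sup>2 < m w" for w
    by (simp add: not_le)
  obtain c where c: "\<sigma> u v < c" "\<And>w. cut_weight U w \<noteq> 0 \<Longrightarrow> cut_weight U w * c\<^sup>2 \<le> m w"
    using enlarge_within_strict_bounds[OF fin, of "cut_weight U" "\<sigma> u v" m] strict by auto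
  have "(\<Sum>v\<in>nbrs b w. b w v * (cut_pseudo_metric U c w v)\<^sup>2) \<le> m w" for w
  proof -
    have "(\<Sum>v\<in>nbrs b w. b w v * (cut_pseudo_metric U c w v)\<^sup>2) =
        (\<Sum>v \<in> {v \<in> nbrs b w. (w \<in> U) \<noteq> (v \<in> U)}. b w v * c\<^sup>2)"
      by (rule sum.mono_neutral_cong_right) (auto simp: cut_pseudo_metric_def finite_nbrs)
    also have "\<dots> = cut_weight U w * c\<^sup>2"
      by (simp add: cut_weight_def sum_distrib_right)
    also have "\<dots> \<le> m w"
      using c(2)[of w] m_pos[of w] by (cases "cut_weight U w = 0") auto
    finally show ?thesis .
  qed
  then have "intrinsic b m (cut_pseudo_metric U c)"
    by (simp add: intrinsic_iff)
  moreover have "0 \<le> c"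
    using c(1) pseudo_metricD(1)[OF pm, of u v] by linarith
  ultimately have "cut_pseudo_metric U c u v \<le> \<sigma> u v"
    using largest pseudo_metric_cut by blast
  then show False
    using uv c(1) by (simp add: cut_pseudo_metric_def)
qed

text \<open>The edges to non-leaf neighbours of \<open>x\<close> are raised together by cutting out \<open>x\<close> with its leaves at
  the height \<open>L\<close> of the shortest such edge. A vertex on the far side of the cut is not saturated:
  it has another edge, to which \<open>\<sigma>\<close> assigns part of the budget and the cut assigns nothing. So \<open>x\<close>
  is saturated. As \<open>\<sigma>\<close> is at least \<open>L\<close> on the edges that cross and positive on edges to
  leaves, it can only respect the same budget if there are no leaves and all lengths equal \<open>L\<close>.\<close>

lemma equidistant_non_leaf_nbrs:
  assumes "y \<in> nbrs b x" "nbrs b y \<noteq> {x}"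
  shows "\<exists>L. \<forall>w\<in>nbrs b x. nbrs b w \<noteq> {x} \<and> \<sigma> x w = L"
proof -
  define U where "U = insert x {w. nbrs b w = {x}}"
  define S where "S = nbrs b x - U"
  have S_sub: "S \<subseteq> nbrs b x" and finS: "finite S"
    using finite_nbrs[of x] by (auto simp: S_def)
  have "y \<in> S"
    using assms nbrs_irrefl by (auto simp: S_def U_def)
  then have "S \<noteq> {}" by blast
  define y0 where "y0 = arg_min_on (\<sigma> x) S"
  have y0: "y0 \<in> S" "\<And>w. w \<in> S \<Longrightarrow> \<sigma> x y0 \<le> \<sigma> x w"
    unfolding y0_def using finS \<open>S \<noteq> {}\<close> by (auto intro: arg_min_if_finite arg_min_least)
  define L where "L = \<sigma> x y0"
  have L: "0 < L" "\<And>w. w \<in> S \<Longrightarrow> L \<le> \<sigma> x w"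
    using y0 pos[of x y0] by (auto simp: L_def S_def U_def)
  have cut_x: "cut_weight U x = (\<Sum>v\<in>S. b x v)"
    unfolding cut_weight_def by (rule sum.cong) (auto simp: S_def U_def)
  have cut_leaf: "cut_weight U w = 0" if "nbrs b w = {x}" for w
  proof -
    have "{v \<in> nbrs b w. (w \<in> U) \<noteq> (v \<in> U)} = {}"
      using that by (auto simp: U_def)
    then show ?thesis by (simp only: cut_weight_def) simp
  qed
  have cut_out: "cut_weight U w = b w x" if "w \<notin> U" for w
  proof (cases "x \<in> nbrs b w")
    case True
    then have "{v \<in> nbrs b w. (w \<in> U) \<noteq> (v \<in> U)} = {x}"
      using that nbrs_sym[of _ w] by (auto simp: U_def)
    then show ?thesis by (simp only: cut_weight_def) simp
  next
    case False
    then have "{v \<in> nbrs b w. (w \<in> U) \<noteq> (v \<in> U)} = {}"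
      using that nbrs_sym[of _ w] by (auto simp: U_def)
    then have "cut_weight U w = 0" by (simp only: cut_weight_def) simp
    then show ?thesis using False b_not_nbr by simp
  qed
  have "{w. cut_weight U w \<noteq> 0} \<subseteq> insert x (nbrs b x)"
  proof
    fix w assume w: "w \<in> {w. cut_weight U w \<noteq> 0}"
    show "w \<in> insert x (nbrs b x)"
    proof (rule ccontr)
      assume far: "w \<notin> insert x (nbrs b x)"
      then have "x \<notin> nbrs b w" using nbrs_sym[of w x] by simp
      then have "b w x = 0" "nbrs b w \<noteq> {x}" using b_not_nbr by auto
      then show False using w far cut_out[of w] by (simp add: U_def)
    qed
  qed
  then have "finite {w. cut_weight U w \<noteq> 0}"
    by (rule finite_subset) (simp add: finite_nbrs)
  moreover have "x \<in> U" "y0 \<notin> U"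
    using y0(1) by (auto simp: U_def S_def)
  ultimately obtain w where w: "m w \<le> cut_weight U w * L\<^sup>2"
    using cut_saturated unfolding L_def by blast
  have "w = x"
  proof (rule ccontr)
    assume "w \<noteq> x"
    have "nbrs b w \<noteq> {x}"
      using w cut_leaf[of w] m_pos[of w] by auto
    then have "w \<notin> U" using \<open>w \<noteq> x\<close> by (simp add: U_def)
    then have mw: "m w \<le> b w x * L\<^sup>2" using w cut_out by simp
    have xw: "x \<in> nbrs b w"
      using mw m_pos[of w] b_not_nbr[of x w] by fastforce
    then obtain z where z: "z \<in> nbrs b w" "z \<noteq> x"
      using \<open>nbrs b w \<noteq> {x}\<close> by blast
    have "w \<in> S" using xw nbrs_sym[of w x] \<open>w \<notin> U\<close> by (simp add: S_def)
    from L(2)[OF this] have "L \<le> \<sigma> w x"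
      using pseudo_metricD(2)[OF pm, of x w] by simp
    then have "b w x * L\<^sup>2 \<le> b w x * (\<sigma> w x)\<^sup>2"
      using L(1) by (intro mult_left_mono power_mono) (auto simp: b_nonneg)
    also have "\<dots> < b w x * (\<sigma> w x)\<^sup>2 + b w z * (\<sigma> w z)\<^sup>2"
      using edge_pos[OF z(1)] by simp
    also have "\<dots> = (\<Sum>v\<in>{x,z}. b w v * (\<sigma> w v)\<^sup>2)"
      using z by simp
    also have "\<dots> \<le> (\<Sum>v\<in>nbrs b w. b w v * (\<sigma> w v)\<^sup>2)"
      using xw z by (intro sum_mono2) (auto simp: finite_nbrs b_nonneg)
    also have "\<dots> \<le> m w" by (rule intrinsicD[OF intr])
    finally show False using mw by simp
  qed
  then have mx: "m x \<le> (\<Sum>v\<in>S. b x v * L\<^sup>2)"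
    using w cut_x by (simp add: sum_distrib_right)
  have total: "(\<Sum>v\<in>nbrs b x. b x v * (\<sigma> x v)\<^sup>2) \<le> m x"
    by (rule intrinsicD[OF intr])
  \<comment> \<open>By how much \<open>\<sigma>\<close> exceeds the cut pseudo metric, edge by edge at \<open>x\<close>; the total is at most 0.\<close>
  define g where "g v = (if v \<in> S then b x v * ((\<sigma> x v)\<^sup>2 - L\<^sup>2) else b x v * (\<sigma> x v)\<^sup>2)" for v
  have g_nonneg: "0 \<le> g v" for v
    using L by (auto simp: g_def b_nonneg intro!: mult_nonneg_nonneg power_mono)
  have "(\<Sum>v\<in>nbrs b x. g v) =
      (\<Sum>v\<in>nbrs b x. b x v * (\<sigma> x v)\<^sup>2 - (if v \<in> S then b x v * L\<^sup>2 else 0))"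
    by (rule sum.cong) (auto simp: g_def algebra_simps)
  also have "\<dots> = (\<Sum>v\<in>nbrs b x. b x v * (\<sigma> x v)\<^sup>2) - (\<Sum>v\<in>S. b x v * L\<^sup>2)"
    using S_sub by (simp add: sum_subtractf sum.If_cases finite_nbrs Int_absorb1)
  also have "\<dots> \<le> 0" using mx total by simp
  finally have "(\<Sum>v\<in>nbrs b x. g v) = 0"
    using g_nonneg by (simp add: order.antisym sum_nonneg)
  then have g0: "g v = 0" if "v \<in> nbrs b x" for v
    using that g_nonneg sum_nonneg_eq_0_iff[OF finite_nbrs] by blast
  have "nbrs b v \<noteq> {x} \<and> \<sigma> x v = L" if v: "v \<in> nbrs b x" for v
  proof -
    have bv: "b x v > 0" and sv: "\<sigma> x v > 0"
      using edge_pos[OF v] by auto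
    have "v \<in> S"
      using g0[OF v] bv sv by (auto simp: g_def split: if_splits)
    moreover from this have "(\<sigma> x v)\<^sup>2 = L\<^sup>2"
      using g0[OF v] bv by (simp add: g_def)
    then have "\<sigma> x v = L"
      using L(1) sv by (simp add: power2_eq_iff)
    ultimately show ?thesis by (auto simp: S_def U_def)
  qed
  then show ?thesis by blast
qed

text \<open>Otherwise equality of edge lengths spreads from \<open>x\<close> over the whole graph, since no leaf is ever
  met. Shortening everything else to \<open>3/4 * L\<close> strictly lowers the budget used at \<open>x\<close> and at \<open>y\<close>,
  as both have a second edge, and this lets the edge between them grow beyond \<open>L\<close>.\<close>

lemma every_edge_has_leaf:
  assumes xy: "y \<in> nbrs b x"
  shows "nbrs b x = {y} \<or> nbrs b y = {x}"
proof (rule ccontr)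
  assume "\<not> ?thesis"
  then have nx: "nbrs b x \<noteq> {y}" and ny: "nbrs b y \<noteq> {x}" by auto
  have yx: "x \<in> nbrs b y" using xy nbrs_sym by blast
  obtain L where "\<forall>w\<in>nbrs b x. nbrs b w \<noteq> {x} \<and> \<sigma> x w = L"
    using equidistant_non_leaf_nbrs[OF xy ny] by blast
  moreover have "nbrs b x \<noteq> {v}" for v
    using nx xy by auto
  ultimately have "(\<forall>w\<in>nbrs b x. nbrs b w \<noteq> {x} \<and> \<sigma> x w = L) \<and> (\<forall>v. nbrs b x \<noteq> {v})"
    by simp
  then have all: "(\<forall>w\<in>nbrs b u. nbrs b w \<noteq> {u} \<and> \<sigma> u w = L) \<and> (\<forall>v. nbrs b u \<noteq> {v})" for u
  proof (rule connected_induct)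
    fix u v
    assume u: "(\<forall>w\<in>nbrs b u. nbrs b w \<noteq> {u} \<and> \<sigma> u w = L) \<and> (\<forall>v. nbrs b u \<noteq> {v})"
      and v: "v \<in> nbrs b u"
    have uv: "u \<in> nbrs b v" using v nbrs_sym by blast
    obtain L' where L': "\<forall>w\<in>nbrs b v. nbrs b w \<noteq> {v} \<and> \<sigma> v w = L'"
      using equidistant_non_leaf_nbrs[OF uv] u by blast
    then have "L' = L"
      using u v uv pseudo_metricD(2)[OF pm, of u v] by auto
    moreover have "nbrs b v \<noteq> {z}" for z using u v uv by auto
    ultimately show "(\<forall>w\<in>nbrs b v. nbrs b w \<noteq> {v} \<and> \<sigma> v w = L) \<and> (\<forall>z. nbrs b v \<noteq> {z})"
      using L' by blast
  qed
  have neq: "x \<noteq> y" using xy nbrs_irrefl by auto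
  then have L: "0 < L" using all[of x] xy pos[of x y] by auto
  define a where "a = 3/4 * L"
  define E where "E = {(x,y),(y,x)}"
  have room: "b s t * L\<^sup>2 < m s - (\<Sum>v\<in>nbrs b s - {t}. b s v * a\<^sup>2)" if st: "(s,t) \<in> E" for s t
  proof -
    have t: "t \<in> nbrs b s" using st xy yx by (auto simp: E_def)
    then obtain z where z: "z \<in> nbrs b s - {t}" using all[of s] by blast
    have "(\<Sum>v\<in>nbrs b s - {t}. b s v * a\<^sup>2) < (\<Sum>v\<in>nbrs b s - {t}. b s v * L\<^sup>2)"
    proof (rule sum_strict_mono)
      fix v assume "v \<in> nbrs b s - {t}"
      then show "b s v * a\<^sup>2 < b s v * L\<^sup>2"
        using L by (intro mult_strict_left_mono power_strict_mono) (auto simp: a_def nbrs_iff)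
    qed (use z finite_nbrs in auto)
    moreover have "b s t * L\<^sup>2 + (\<Sum>v\<in>nbrs b s - {t}. b s v * L\<^sup>2) = (\<Sum>v\<in>nbrs b s. b s v * L\<^sup>2)"
      using t by (simp add: sum.remove[OF finite_nbrs])
    moreover have "(\<Sum>v\<in>nbrs b s. b s v * L\<^sup>2) = (\<Sum>v\<in>nbrs b s. b s v * (\<sigma> s v)\<^sup>2)"
      using all[of s] by (intro sum.cong) auto
    ultimately show ?thesis using intrinsicD[OF intr, of s] by linarith
  qed
  obtain c' where c': "L < c'"
      "\<And>s t. (s,t) \<in> E \<Longrightarrow> b s t * c'\<^sup>2 \<le> m s - (\<Sum>v\<in>nbrs b s - {t}. b s v * a\<^sup>2)"
    using enlarge_within_strict_bounds[of E "\<lambda>(s,t). b s t" L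
        "\<lambda>(s,t). m s - (\<Sum>v\<in>nbrs b s - {t}. b s v * a\<^sup>2)"] room
    by (force simp: E_def)
  \<comment> \<open>The bound \<open>2 * a\<close> secures the triangle inequality; it exceeds \<open>L\<close> because \<open>a = 3/4 * L\<close>.\<close>
  define c where "c = min c' (2 * a)"
  have c: "L < c" "c \<le> 2 * a" "c \<le> c'" using c'(1) L by (auto simp: c_def a_def)
  define \<rho> where "\<rho> u v = (if u = v then 0 else if (u,v) \<in> E then c else a)" for u v
  have "pseudo_metric \<rho>"
    by (rule pseudo_metric_two_to_one[of a]) (use c L in \<open>auto simp: \<rho>_def E_def a_def\<close>)
  moreover have "intrinsic b m \<rho>"
    unfolding intrinsic_iff
  proof
    fix s
    show "(\<Sum>v\<in>nbrs b s. b s v * (\<rho> s v)\<^sup>2) \<le> m s"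
    proof (cases "\<exists>t. (s,t) \<in> E")
      case True
      then obtain t where st: "(s,t) \<in> E" by blast
      have t: "t \<in> nbrs b s" using st xy yx by (auto simp: E_def)
      have "(\<Sum>v\<in>nbrs b s. b s v * (\<rho> s v)\<^sup>2) =
          b s t * (\<rho> s t)\<^sup>2 + (\<Sum>v\<in>nbrs b s - {t}. b s v * (\<rho> s v)\<^sup>2)"
        using t by (rule sum.remove[OF finite_nbrs])
      also have "(\<Sum>v\<in>nbrs b s - {t}. b s v * (\<rho> s v)\<^sup>2) = (\<Sum>v\<in>nbrs b s - {t}. b s v * a\<^sup>2)"
        using st neq nbrs_irrefl[of s] by (intro sum.cong) (auto simp: \<rho>_def E_def)
      also have "\<rho> s t = c"
        using st neq by (auto simp: \<rho>_def E_def)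
      also have "b s t * c\<^sup>2 \<le> b s t * c'\<^sup>2"
        using c L by (intro mult_left_mono power_mono) (auto simp: b_nonneg)
      finally show ?thesis using c'(2)[OF st] by linarith
    next
      case False
      have "(\<Sum>v\<in>nbrs b s. b s v * (\<rho> s v)\<^sup>2) \<le> (\<Sum>v\<in>nbrs b s. b s v * (\<sigma> s v)\<^sup>2)"
        using False all[of s] L
        by (intro sum_mono mult_left_mono power_mono) (auto simp: \<rho>_def a_def b_nonneg)
      then show ?thesis using intrinsicD[OF intr, of s] by linarith
    qed
  qed
  ultimately have "\<rho> x y \<le> \<sigma> x y" by (rule largest)
  moreover have "\<sigma> x y = L" using all[of x] xy by blast
  ultimately show False
    using c(1) neq by (simp add: \<rho>_def E_def)
qed

text \<open>Cutting off the leaf alone crosses a single edge, so that one of its two ends must be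
  saturated by this edge.\<close>

lemma leaf_edge_long:
  assumes leaf: "nbrs b x = {p}"
  shows "min (m x) (m p) \<le> b p x * (\<sigma> p x)\<^sup>2"
proof -
  have px: "x \<in> nbrs b p" using leaf nbrs_sym by blast
  have neq: "x \<noteq> p" using px nbrs_irrefl by auto
  have cut: "cut_weight {x} w = (if w = x \<or> w = p then b p x else 0)" for w
  proof -
    have "{v \<in> nbrs b w. (w \<in> {x}) \<noteq> (v \<in> {x})} = (if w = x then {p} else if w = p then {x} else {})"
      using leaf neq px nbrs_sym[of x w] by auto
    then show ?thesis unfolding cut_weight_def using b_sym[of x p] by auto
  qed
  have "finite {w. cut_weight {x} w \<noteq> 0}"
    by (rule finite_subset[of _ "{x,p}"]) (auto simp: cut)
  then obtain w where w: "m w \<le> cut_weight {x} w * (\<sigma> x p)\<^sup>2"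
    using cut_saturated[of "{x}" x p] neq by auto
  then have "w = x \<or> w = p"
    using m_pos[of w] by (auto simp: cut split: if_splits)
  then show ?thesis
    using w pseudo_metricD(2)[OF pm, of x p] by (auto simp: cut split: if_splits)
qed

text \<open>A vertex with at least two neighbours is the center: none of its edges saturates it alone, so
  by \<open>leaf_edge_long\<close> every leaf is saturated, and the budget of the center pays for all their
  masses. If every vertex has exactly one neighbour, the graph is a single edge, and its heavier end
  serves as center. The remaining graph, an isolated vertex, satisfies the inequality of masses
  trivially.\<close>

lemma star_with_heavy_center:
  "\<exists>p. (\<forall>x. x \<noteq> p \<longrightarrow> nbrs b x = {p}) \<and> nbrs b p = UNIV - {p} \<and> (\<Sum>x\<in>nbrs b p. m x) \<le> m p"
proof -
  have star: "(\<forall>x. x \<noteq> p \<longrightarrow> nbrs b x = {p}) \<and> nbrs b p = UNIV - {p}"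
    if "\<And>x. x \<in> nbrs b p \<Longrightarrow> nbrs b x = {p}" for p
  proof -
    have "x = p \<or> x \<in> nbrs b p" for x
      by (rule connected_induct[of _ p]) (use that in auto)
    then show ?thesis using that nbrs_irrefl by auto
  qed
  show ?thesis
  proof (cases "\<exists>p. \<forall>q. nbrs b p \<noteq> {q}")
    case True
    then obtain p where p: "\<And>q. nbrs b p \<noteq> {q}" by blast
    have leaf: "nbrs b x = {p}" if "x \<in> nbrs b p" for x
      using every_edge_has_leaf[OF that] p by blast
    define f where "f x = b p x * (\<sigma> p x)\<^sup>2" for x
    have f_pos: "0 < f x" if "x \<in> nbrs b p" for x
      using edge_pos[OF that] by (simp add: f_def)
    have f_ge: "m x \<le> f x" if x: "x \<in> nbrs b p" for x
    proof -
      obtain z where z: "z \<in> nbrs b p" "z \<noteq> x" using p x by blast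
      have "f x + f z = (\<Sum>v\<in>{x,z}. f v)" using z by simp
      also have "\<dots> \<le> (\<Sum>v\<in>nbrs b p. f v)"
        using x z f_pos by (intro sum_mono2) (auto simp: finite_nbrs less_imp_le)
      also have "\<dots> \<le> m p" unfolding f_def by (rule intrinsicD[OF intr])
      finally have "f x < m p" using f_pos[OF z(1)] by simp
      then show ?thesis using leaf_edge_long[OF leaf[OF x]] by (simp add: f_def)
    qed
    have "(\<Sum>x\<in>nbrs b p. m x) \<le> (\<Sum>x\<in>nbrs b p. f x)"
      by (rule sum_mono) (rule f_ge)
    also have "\<dots> \<le> m p" unfolding f_def by (rule intrinsicD[OF intr])
    finally show ?thesis using star[of p] leaf by blast
  next
    case False
    then obtain p q where pq: "nbrs b p = {q}" by blast
    have "nbrs b q = {p}" using False pq nbrs_sym by (metis singletonD singletonI)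
    show ?thesis
    proof (cases "m q \<le> m p")
      case True
      then have "(\<Sum>x\<in>nbrs b p. m x) \<le> m p"
        using pq \<open>nbrs b q = {p}\<close> by simp
      moreover have "nbrs b x = {p}" if "x \<in> nbrs b p" for x
        using that pq \<open>nbrs b q = {p}\<close> by simp
      ultimately show ?thesis using star[of p] by blast
    next
      case False
      then have "(\<Sum>x\<in>nbrs b q. m x) \<le> m q"
        using pq \<open>nbrs b q = {p}\<close> by simp
      moreover have "nbrs b x = {q}" if "x \<in> nbrs b q" for x
        using that pq \<open>nbrs b q = {p}\<close> by simp
      ultimately show ?thesis using star[of q] by blast
    qed
  qed
qed

end

section \<open>Stars with a heavy center\<close>

context lf_connected_graph
begin

lemma star_nbrs:
  assumes "is_center b p"
  shows "x \<noteq> p \<Longrightarrow> nbrs b x = {p}" "nbrs b p = UNIV - {p}"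
proof -
  have one: "\<exists>q. nbrs b x = {q}" if "x \<noteq> p" for x
    using assms that unfolding is_center_def num_neighbours_def nbrs_def
    by (metis card_1_singletonE)
  \<comment> \<open>Two adjacent vertices of degree one form a component, which would miss \<open>p\<close>.\<close>
  show leaf: "nbrs b x = {p}" if x: "x \<noteq> p" for x
  proof (rule ccontr)
    assume "nbrs b x \<noteq> {p}"
    with one[OF x] obtain q where q: "nbrs b x = {q}" "q \<noteq> p" by auto
    then have "nbrs b q = {x}"
      using one[of q] nbrs_sym[of q x] by auto
    then have "p = x \<or> p = q"
      using q by (intro connected_induct[of "\<lambda>z. z = x \<or> z = q" x p]) auto
    then show False using x q by auto
  qed
  show "nbrs b p = UNIV - {p}"
  proof (rule set_eqI)
    fix x
    show "x \<in> nbrs b p \<longleftrightarrow> x \<in> UNIV - {p}"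
      using leaf[of x] nbrs_sym[of x p] nbrs_irrefl[of p] by (cases "x = p") auto
  qed
qed

text \<open>The single edge of a leaf \<open>x\<close> can have length at most \<open>w x = sqrt (m x / b x p)\<close>. If the center
  is heavy enough, all these lengths are possible simultaneously, and the path metric they generate
  is the largest by the triangle inequality through \<open>p\<close>.\<close>

lemma heavy_star_largest_metric:
  assumes p: "is_center b p" and mass: "(\<Sum>x\<in>UNIV - {p}. m x) \<le> m p"
  shows "\<exists>\<sigma>. Metric_space UNIV \<sigma> \<and> intrinsic b m \<sigma> \<and>
    (\<forall>\<rho>. pseudo_metric \<rho> \<longrightarrow> intrinsic b m \<rho> \<longrightarrow> (\<forall>x y. \<rho> x y \<le> \<sigma> x y))"
proof -
  note nb = star_nbrs[OF p]
  define w where "w x = (if x = p then 0 else sqrt (m x / b x p))" for x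
  define \<sigma> where "\<sigma> x y = (if x = y then 0 else w x + w y)" for x y
  have bp: "b x p > 0" if "x \<noteq> p" for x
    using nb(1)[OF that] nbrs_iff[of p x] by simp
  have w: "0 \<le> w x" "x \<noteq> p \<Longrightarrow> 0 < w x" "x \<noteq> p \<Longrightarrow> b x p * (w x)\<^sup>2 = m x" for x
    using bp[of x] m_pos[of x] by (auto simp: w_def less_imp_le)
  have wp: "w p = 0" by (simp add: w_def)
  have \<sigma>_pos: "0 < \<sigma> x y" if "x \<noteq> y" for x y
    using w(1,2)[of x] w(1,2)[of y] that by (cases "x = p") (auto simp: \<sigma>_def add_pos_nonneg add_nonneg_pos)
  have "pseudo_metric \<sigma>"
  proof (rule pseudo_metricI)
    fix x y z
    show "\<sigma> x z \<le> \<sigma> x y + \<sigma> y z"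
      using w(1)[of x] w(1)[of y] w(1)[of z] by (auto simp: \<sigma>_def)
  qed (auto simp: \<sigma>_def w)
  then have metric: "Metric_space UNIV \<sigma>"
    using \<sigma>_pos by (auto simp: Metric_space_UNIV_iff_pseudo_metric less_le)
  have "intrinsic b m \<sigma>"
    unfolding intrinsic_iff
  proof
    fix x
    show "(\<Sum>y\<in>nbrs b x. b x y * (\<sigma> x y)\<^sup>2) \<le> m x"
    proof (cases "x = p")
      case False
      then show ?thesis using nb(1)[OF False] w(3)[of x] by (simp add: \<sigma>_def wp)
    next
      case True
      have "(\<Sum>y\<in>nbrs b p. b p y * (\<sigma> p y)\<^sup>2) = (\<Sum>y\<in>UNIV - {p}. m y)"
        unfolding nb(2) by (rule sum.cong) (auto simp: \<sigma>_def wp w(3)[symmetric] b_sym)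
      then show ?thesis using mass True by simp
    qed
  qed
  moreover have "\<rho> x y \<le> \<sigma> x y" if \<rho>: "pseudo_metric \<rho>" "intrinsic b m \<rho>" for \<rho> x y
  proof -
    have le_w: "\<rho> x p \<le> w x" for x
    proof (cases "x = p")
      case False
      have "(\<rho> x p)\<^sup>2 \<le> m x / b x p"
        using intrinsic_edge_le[OF \<rho>(2), of x p] bp[OF False] by (simp add: field_simps)
      then show ?thesis using False real_le_rsqrt by (simp add: w_def)
    qed (simp add: wp pseudo_metricD \<rho>)
    show ?thesis
      using pseudo_metricD(4)[OF \<rho>(1), of x y p] pseudo_metricD(2)[OF \<rho>(1), of p y]
        le_w[of x] le_w[of y] pseudo_metricD(3)[OF \<rho>(1), of x]
      by (auto simp: \<sigma>_def)
  qed
  ultimately show ?thesis using metric by blast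
qed

end

section \<open>Uniqueness of the maximal intrinsic metric\<close>

theorem theorem3p8:
  fixes b :: "'a::countable \<Rightarrow> 'a \<Rightarrow> real" and m :: "'a \<Rightarrow> real"
  assumes "\<And>x. m x > 0"
    and "weighted_graph b"
    and "locally_finite_graph b"
    and "connected_graph b"
  shows "(\<exists>!\<sigma>. Metric_space UNIV \<sigma> \<and> maximal_intrinsic b m \<sigma>) \<longleftrightarrow>
    (star_graph b \<and>
     (\<exists>p. is_center b p \<and> m summable_on (UNIV - {p}) \<and> (\<Sum>\<^sub>\<infinity>x\<in>UNIV - {p}. m x) \<le> m p))"
    (is "?unique \<longleftrightarrow> ?star")
proof -
  interpret lf_connected_graph b m
    using assms by unfold_locales
  show ?thesis
  proof
    assume ?unique
    then obtain \<sigma> where \<sigma>: "Metric_space UNIV \<sigma>" "maximal_intrinsic b m \<sigma>"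
      and unique: "\<And>\<tau>. Metric_space UNIV \<tau> \<Longrightarrow> maximal_intrinsic b m \<tau> \<Longrightarrow> \<tau> = \<sigma>"
      by (metis (no_types, lifting))
    interpret largest_intrinsic_metric b m \<sigma>
    proof
      show "pseudo_metric \<sigma>" "intrinsic b m \<sigma>"
        using \<sigma>(2) by (auto simp: maximal_intrinsic_def)
      show "0 < \<sigma> x y" if "x \<noteq> y" for x y
        using \<sigma>(1) that unfolding Metric_space_UNIV_iff_pseudo_metric
        by (metis less_eq_real_def pseudo_metricD(1))
      show "\<rho> x y \<le> \<sigma> x y" if "pseudo_metric \<rho>" "intrinsic b m \<rho>" for \<rho> x y
        using unique_maximal_metric_is_largest[OF \<sigma> unique that] .
    qed
    obtain p where p: "\<forall>x. x \<noteq> p \<longrightarrow> nbrs b x = {p}" "nbrs b p = UNIV - {p}"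
        "(\<Sum>x\<in>nbrs b p. m x) \<le> m p"
      using star_with_heavy_center by blast
    have "is_center b p"
      using p(1) by (simp add: is_center_def num_neighbours_def nbrs_def)
    moreover have "finite (UNIV - {p})"
      using finite_nbrs[of p] p(2) by simp
    ultimately show ?star
      using p(2,3) conn by (auto simp: star_graph_def)
  next
    assume ?star
    then obtain p where p: "is_center b p" "(\<Sum>\<^sub>\<infinity>x\<in>UNIV - {p}. m x) \<le> m p"
      by blast
    have "finite (UNIV - {p})"
      using finite_nbrs[of p] star_nbrs(2)[OF p(1)] by simp
    then obtain \<sigma> where \<sigma>: "Metric_space UNIV \<sigma>" "intrinsic b m \<sigma>"
      and largest: "\<And>\<rho> x y. pseudo_metric \<rho> \<Longrightarrow> intrinsic b m \<rho> \<Longrightarrow> \<rho> x y \<le> \<sigma> x y"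
      using heavy_star_largest_metric[OF p(1)] p(2) by auto
    have pm: "pseudo_metric \<sigma>"
      using \<sigma>(1) by (simp add: Metric_space_UNIV_iff_pseudo_metric)
    have "maximal_intrinsic b m \<sigma>"
      unfolding maximal_intrinsic_def using pm \<sigma>(2) largest
      by (auto intro!: ext order.antisym)
    moreover have "\<tau> = \<sigma>" if "maximal_intrinsic b m \<tau>" for \<tau>
      using that pm \<sigma>(2) largest[of \<tau>] unfolding maximal_intrinsic_def by blast
    ultimately show ?unique using \<sigma>(1) by blast
  qed
qed

end
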